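(* Let $k\ge 1$ be an integer and let $S_k(x)=\sum_{n\ge 1}s_k(P_2\times P_n)x^n$ be the generating function of the number of staircase $(P_2\times P_n,k)$-words, where $P_2\times P_n$ is the grid graph of size $2\times n$. Put $$t_{1,2}=\frac{2-x\pm\sqrt{x(9x+8)}+\sqrt{\left(2-x\pm\sqrt{x(9x+8)}\right)^2-16x^2}}{4x}$$ (upper signs for $t_1$, lower signs for $t_2$). Then $$S_k(x)=\frac{a_1(x,t_1,t_2)t_1^kt_2^k+a_2(x,t_1,t_2)t_1^k-a_2(x,t_2,t_1)t_2^k+a_3(x,t_1,t_2)}{(t_1-1)(t_2-1)(4x^2-7x+1)\left(b_1(x,t_1,t_2)t_1^kt_2^k+b_2(x,t_1,t_2)t_1^k-b_2(x,t_2,t_1)t_2^k+b_3(x,t_1,t_2)\right)},$$ where \begin{align*} a_1(x,t_1,t_2)&=t_1t_2(t_2-t_1)\Big(2k(t_2^2-1)(t_1^2-1)x^3\\ &\quad+(-3kt_1^2t_2^2+3kt_1^2-2kt_1t_2+3kt_2^2-2t_1^2t_2-2t_1t_2^2+2kt_1+2kt_2-2t_1t_2-5k-2)x^2\\ &\quad+(3kt_1t_2+2t_1^2t_2+2t_1t_2^2-3kt_1-3kt_2+6t_1t_2+3k+4)x-2t_2t_1\Big),\\ a_2(x,t_1,t_2)&=t_1(1-t_1t_2)\Big(2k(t_1-1)(t_2+1)(t_2-1)(t_1+1)x^3\\ &\quad+(-3kt_1^2t_2^2-2kt_1t_2^2+3kt_1^2+2kt_1t_2+5kt_2^2+2t_1^2t_2-2kt_2+2t_1t_2+2t_2^2-3k+2t_1)x^2\\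 &\quad+(3kt_1t_2^2-3kt_1t_2-3kt_2^2-2t_1^2t_2+3kt_2-6t_1t_2-4t_2^2-2t_1)x+2t_2t_1\Big),\\ a_3(x,t_1,t_2)&=(t_1-t_2)\Big(2k(t_1^2-1)(t_2^2-1)x^3\\ &\quad+(-5kt_1^2t_2^2+2kt_1^2t_2+2kt_1t_2^2-2t_1^2t_2^2+3kt_1^2-2kt_1t_2+3kt_2^2-2t_1t_2-3k-2t_1-2t_2)x^2\\ &\quad+(3kt_1^2t_2^2-3kt_1^2t_2-3kt_1t_2^2+4t_1^2t_2^2+3kt_1t_2+6t_1t_2+2t_1+2t_2)x-2t_1t_2\Big),\\ b_1(x,t_1,t_2)&=t_1t_2(t_1-t_2)\big((t_1+1)(t_2+1)x-1\big),\\ b_2(x,t_1,t_2)&=t_1(t_1t_2-1)\big((t_1+1)(t_2+1)x-t_2\big),\\ b_3(x,t_1,t_2)&=(t_2-t_1)\big((t_1+1)(t_2+1)x-t_1t_2\big). \end{align*}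
   Context: For a positive integer $k$ write $[k]=\{1,\dots,k\}$. For a graph $G$ with vertex set $V$, a $(G,k)$-word is a function $w\colon V\to[k]$; it is called staircase if $|w(u)-w(v)|\le 1$ for all adjacent $u,v\in V$. The number of staircase $(G,k)$-words is denoted $s_k(G)$. The grid graph $P_2\times P_n$ of size $2\times n$ has vertex set $\{(i,j): i\in\{1,2\},\ 1\le j\le n\}$, with $(i_1,j_1)$ and $(i_2,j_2)$ adjacent iff $|i_1-i_2|+|j_1-j_2|=1$. The notation $a_2(x,t_2,t_1)$, $b_2(x,t_2,t_1)$ means the same expressions with $t_1$ and $t_2$ interchanged. The identity is one of algebraic functions of $x$; concretely it may be read as holding for all sufficiently small real $x>0$, with nonnegative real square roots. *)

theory Defs
  imports "HOL-Analysis.Analysis"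
begin

text \<open>
  A graph is given by a vertex set \<open>V\<close> and an adjacency relation \<open>adj\<close>.  Words are taken in the
  extensional function space, so that every function from \<open>V\<close> to \<open>{1..k}\<close> is counted exactly once.
\<close>

definition staircase_words :: "'a set \<Rightarrow> ('a \<Rightarrow> 'a \<Rightarrow> bool) \<Rightarrow> nat \<Rightarrow> ('a \<Rightarrow> nat) set" where
  "staircase_words V adj k =
     {w \<in> V \<rightarrow>\<^sub>E {1..k}. \<forall>u\<in>V. \<forall>v\<in>V. adj u v \<longrightarrow> \<bar>int (w u) - int (w v)\<bar> \<le> 1}"

definition num_staircase :: "'a set \<Rightarrow> ('a \<Rightarrow> 'a \<Rightarrow> bool) \<Rightarrow> nat \<Rightarrow> nat" where
  "num_staircase V adj k = card (staircase_words V adj k)"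

definition grid_verts :: "nat \<Rightarrow> (nat \<times> nat) set" where
  "grid_verts n = {1, 2} \<times> {1..n}"

definition grid_adj :: "nat \<times> nat \<Rightarrow> nat \<times> nat \<Rightarrow> bool" where
  "grid_adj u v \<longleftrightarrow>
     \<bar>int (fst u) - int (fst v)\<bar> + \<bar>int (snd u) - int (snd v)\<bar> = 1"

definition staircase_gf :: "nat \<Rightarrow> real fps" where
  "staircase_gf k =
     Abs_fps (\<lambda>n. if n = 0 then 0 else real (num_staircase (grid_verts n) grid_adj k))"

definition t1 :: "real \<Rightarrow> real" where
  "t1 x = (2 - x + sqrt (x * (9 * x + 8))
            + sqrt ((2 - x + sqrt (x * (9 * x + 8)))^2 - 16 * x^2)) / (4 * x)"

definition t2 :: "real \<Rightarrow> real" where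
  "t2 x = (2 - x - sqrt (x * (9 * x + 8))
            + sqrt ((2 - x - sqrt (x * (9 * x + 8)))^2 - 16 * x^2)) / (4 * x)"

text \<open>
  The polynomials \<open>a1\<close>, \<open>a2\<close>, \<open>a3\<close> also depend on \<open>k\<close>.  Below, \<open>p\<close> and \<open>q\<close> are the second and the
  third argument of \<open>a\<^sub>i(x, p, q)\<close> and \<open>b\<^sub>i(x, p, q)\<close>.
\<close>

definition a1 :: "real \<Rightarrow> real \<Rightarrow> real \<Rightarrow> real \<Rightarrow> real" where
  "a1 k x p q = p * q * (q - p) *
     (2*k*(q^2 - 1)*(p^2 - 1) * x^3
      + (-3*k*p^2*q^2 + 3*k*p^2 - 2*k*p*q + 3*k*q^2 - 2*p^2*q - 2*p*q^2
         + 2*k*p + 2*k*q - 2*p*q - 5*k - 2) * x^2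
      + (3*k*p*q + 2*p^2*q + 2*p*q^2 - 3*k*p - 3*k*q + 6*p*q + 3*k + 4) * x
      - 2*q*p)"

definition a2 :: "real \<Rightarrow> real \<Rightarrow> real \<Rightarrow> real \<Rightarrow> real" where
  "a2 k x p q = p * (1 - p*q) *
     (2*k*(p - 1)*(q + 1)*(q - 1)*(p + 1) * x^3
      + (-3*k*p^2*q^2 - 2*k*p*q^2 + 3*k*p^2 + 2*k*p*q + 5*k*q^2 + 2*p^2*q
         - 2*k*q + 2*p*q + 2*q^2 - 3*k + 2*p) * x^2
      + (3*k*p*q^2 - 3*k*p*q - 3*k*q^2 - 2*p^2*q + 3*k*q - 6*p*q - 4*q^2 - 2*p) * x
      + 2*q*p)"

definition a3 :: "real \<Rightarrow> real \<Rightarrow> real \<Rightarrow> real \<Rightarrow> real" where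
  "a3 k x p q = (p - q) *
     (2*k*(p^2 - 1)*(q^2 - 1) * x^3
      + (-5*k*p^2*q^2 + 2*k*p^2*q + 2*k*p*q^2 - 2*p^2*q^2 + 3*k*p^2 - 2*k*p*q
         + 3*k*q^2 - 2*p*q - 3*k - 2*p - 2*q) * x^2
      + (3*k*p^2*q^2 - 3*k*p^2*q - 3*k*p*q^2 + 4*p^2*q^2 + 3*k*p*q + 6*p*q
         + 2*p + 2*q) * x
      - 2*p*q)"

definition b1 :: "real \<Rightarrow> real \<Rightarrow> real \<Rightarrow> real" where
  "b1 x p q = p * q * (p - q) * ((p + 1)*(q + 1)*x - 1)"

definition b2 :: "real \<Rightarrow> real \<Rightarrow> real \<Rightarrow> real" where
  "b2 x p q = p * (p*q - 1) * ((p + 1)*(q + 1)*x - q)"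

definition b3 :: "real \<Rightarrow> real \<Rightarrow> real \<Rightarrow> real" where
  "b3 x p q = (q - p) * ((p + 1)*(q + 1)*x - p*q)"

end

theory Submission
  imports Defs
begin

text \<open>
  Reading a word column by column, the possible columns are \<open>(i, i)\<close>, \<open>(i, i + 1)\<close> and
  \<open>(i + 1, i)\<close>.  Let \<open>D\<^sub>i\<close> and \<open>E\<^sub>i\<close> be the generating functions of the words ending in \<open>(i, i)\<close>
  and in \<open>(i, i + 1)\<close>.  They satisfy a linear recurrence in \<open>i\<close> with constant coefficients, with
  boundary values \<open>D\<^sub>0 = E\<^sub>0 = D\<^sub>k\<^sub>+\<^sub>1 = E\<^sub>k = 0\<close>.  A homogeneous solution proportional to \<open>t\<^sup>i\<close> requires
  \<open>t + 1 / t\<close> to be one of the two roots of a quadratic over \<open>x\<close>, so \<open>t\<close> is one of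
  \<open>t\<^sub>1, 1 / t\<^sub>1, t\<^sub>2, 1 / t\<^sub>2\<close>; the solution symmetric under \<open>i \<mapsto> k + 1 - i\<close> that
  meets the boundary conditions is found by Cramer's rule, and summing it gives the formula.
  Conversely, for \<open>0 \<le> x < 1 / 9\<close> any solution of the linear system is the sum of the power series,
  because a column has at most \<open>9\<close> successors.
\<close>

section \<open>Columns as states, and the recursion for words by their last column\<close>

definition close :: "nat \<Rightarrow> nat \<Rightarrow> bool" where
  "close a b \<longleftrightarrow> \<bar>int a - int b\<bar> \<le> 1"

definition states :: "nat \<Rightarrow> (nat \<times> nat) set" where
  "states k = {(a, b). a \<in> {1..k} \<and> b \<in> {1..k} \<and> close a b}"

definition nbrs :: "nat \<Rightarrow> nat \<times> nat \<Rightarrow> (nat \<times> nat) set" where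
  "nbrs k s = {r \<in> states k. close (fst r) (fst s) \<and> close (snd r) (snd s)}"

abbreviation grid_words :: "nat \<Rightarrow> nat \<Rightarrow> (nat \<times> nat \<Rightarrow> nat) set" where
  "grid_words k n \<equiv> staircase_words (grid_verts n) grid_adj k"

definition words_ending :: "nat \<Rightarrow> nat \<Rightarrow> nat \<times> nat \<Rightarrow> (nat \<times> nat \<Rightarrow> nat) set" where
  "words_ending k n s = {w \<in> grid_words k n. (w (1, n), w (2, n)) = s}"

lemma finite_states: "finite (states k)"
  by (rule finite_subset[of _ "{1..k} \<times> {1..k}"]) (auto simp: states_def)

lemma nbrs_subset: "nbrs k s \<subseteq> states k"
  by (auto simp: nbrs_def)

lemma card_nbrs_le: "card (nbrs k s) \<le> 9"
proof -
  have "nbrs k s \<subseteq> {fst s - 1..fst s + 1} \<times> {snd s - 1..snd s + 1}"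
    by (auto simp: nbrs_def close_def)
  then have "card (nbrs k s) \<le> card ({fst s - 1..fst s + 1} \<times> {snd s - 1..snd s + 1})"
    by (intro card_mono) auto
  also have "\<dots> \<le> 3 * 3"
    unfolding card_cartesian_product by (intro mult_mono) auto
  finally show ?thesis by simp
qed

lemma finite_grid_words: "finite (grid_words k n)"
proof -
  have "finite (grid_verts n \<rightarrow>\<^sub>E {1..k})"
    by (intro finite_PiE) (auto simp: grid_verts_def)
  then show ?thesis
    by (rule rev_finite_subset) (auto simp: staircase_words_def)
qed

lemma close_iff: "close a b \<longleftrightarrow> a = b \<or> b = Suc a \<or> a = Suc b"
  by (auto simp: close_def)

lemma close_commute: "close a b \<longleftrightarrow> close b a"
  by (auto simp: close_iff)

text \<open>Every edge of the grid joins either the two cells of one column or horizontally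
  consecutive cells, and \<open>close\<close> is symmetric, so each edge has to be tested in one
  direction only. This form separates the conditions on the last column from those on the shorter
  word.\<close>

lemma grid_words_iff:
  "w \<in> grid_words k n \<longleftrightarrow>
     w \<in> grid_verts n \<rightarrow>\<^sub>E {1..k} \<and> (\<forall>j\<in>{1..n}. close (w (1, j)) (w (2, j)))
     \<and> (\<forall>j. 1 \<le> j \<longrightarrow> j < n \<longrightarrow> close (w (1, j)) (w (1, Suc j)) \<and> close (w (2, j)) (w (2, Suc j)))"
  (is "?L \<longleftrightarrow> ?E \<and> ?C \<and> ?R")
proof
  assume L: ?L
  then have *: "close (w u) (w v)" if "u \<in> grid_verts n" "v \<in> grid_verts n" "grid_adj u v" for u v
    using that by (auto simp: staircase_words_def close_def)
  have ?E
    using L by (simp add: staircase_words_def)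
  moreover have ?C
    by (intro ballI *) (auto simp: grid_verts_def grid_adj_def)
  moreover have ?R
    by (intro allI impI conjI *) (auto simp: grid_verts_def grid_adj_def)
  ultimately show "?E \<and> ?C \<and> ?R" by blast
next
  assume R: "?E \<and> ?C \<and> ?R"
  have "close (w u) (w v)" if uv: "u \<in> grid_verts n" "v \<in> grid_verts n" "grid_adj u v" for u v
  proof -
    obtain i j i' j' where ij: "u = (i, j)" "v = (i', j')"
      by (cases u, cases v)
    have i: "i = 1 \<or> i = 2" "i' = 1 \<or> i' = 2" and j: "j \<in> {1..n}" "j' \<in> {1..n}"
      using uv by (auto simp: ij grid_verts_def)
    have adj: "\<bar>int i - int i'\<bar> + \<bar>int j - int j'\<bar> = 1"
      using uv by (simp add: ij grid_adj_def)
    have "i = i' \<and> j' = Suc j \<or> i = i' \<and> j = Suc j' \<or> j = j' \<and> i = 1 \<and> i' = 2 \<or> j = j' \<and> i = 2 \<and> i' = 1"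
      using i adj by presburger
    then show ?thesis
      using R i j by (elim disjE) (auto simp: ij close_commute)
  qed
  with R show ?L
    by (auto simp: staircase_words_def close_def)
qed

lemma last_column_states:
  assumes "n \<ge> 1" "w \<in> grid_words k n"
  shows "(w (1, n), w (2, n)) \<in> states k"
proof -
  have "w \<in> grid_verts n \<rightarrow>\<^sub>E {1..k}" "close (w (1, n)) (w (2, n))"
    using assms by (auto simp: grid_words_iff)
  moreover have "(1, n) \<in> grid_verts n" "(2, n) \<in> grid_verts n"
    using assms(1) by (auto simp: grid_verts_def)
  ultimately have "w (1, n) \<in> {1..k}" "w (2, n) \<in> {1..k}" "close (w (1, n)) (w (2, n))"
    by (blast dest: PiE_mem)+
  then show ?thesis
    by (simp add: states_def)
qed

lemma card_grid_words_by_column: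
  assumes "n \<ge> 1"
  shows "card {w \<in> grid_words k n. Q (w (1, n), w (2, n))}
       = (\<Sum>s\<in>{s \<in> states k. Q s}. card (words_ending k n s))"
proof -
  let ?S = "{w \<in> grid_words k n. Q (w (1, n), w (2, n))}"
  have fin: "finite ?S"
    using finite_grid_words by simp
  have "card ?S = (\<Sum>s\<in>{s \<in> states k. Q s}. \<Sum>w\<in>{w\<in>?S. (w (1, n), w (2, n)) = s}. 1)"
    using last_column_states[OF assms] finite_states
    by (subst sum.group[OF fin]) auto
  also have "\<dots> = (\<Sum>s\<in>{s \<in> states k. Q s}. card (words_ending k n s))"
    by (rule sum.cong) (auto simp: words_ending_def intro!: arg_cong[where f=card])
  finally show ?thesis .
qed

text \<open>Deleting the last column is a bijection whose inverse appends \<open>s\<close>. The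
  disjunct \<open>n = 0\<close> covers the first column, which has no predecessor to be compatible
  with.\<close>

lemma card_words_ending_Suc:
  assumes "s \<in> states k"
  shows "card (words_ending k (Suc n) s)
       = card {w \<in> grid_words k n. n = 0 \<or> (w (1, n), w (2, n)) \<in> nbrs k s}"
proof -
  obtain a b where s: "s = (a, b)" by (cases s)
  have ab: "a \<in> {1..k}" "b \<in> {1..k}" "close a b"
    using assms by (auto simp: s states_def)
  let ?ext = "\<lambda>w. w((1, Suc n) := a, (2, Suc n) := b)"
  let ?A = "{w \<in> grid_words k n. n = 0 \<or> (w (1, n), w (2, n)) \<in> nbrs k s}"
  have verts: "grid_verts (Suc n) = insert (2, Suc n) (insert (1, Suc n) (grid_verts n))"
    by (auto simp: grid_verts_def)
  have fresh: "(i, Suc n) \<notin> grid_verts n" for i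
    by (auto simp: grid_verts_def)
  have "bij_betw ?ext ?A (words_ending k (Suc n) s)"
  proof (rule bij_betw_byWitness[where f' = "\<lambda>w. restrict w (grid_verts n)"])
    show "\<forall>w\<in>?A. restrict (?ext w) (grid_verts n) = w"
    proof
      fix w assume "w \<in> ?A"
      then have "w \<in> grid_verts n \<rightarrow>\<^sub>E {1..k}"
        by (simp add: grid_words_iff)
      then show "restrict (?ext w) (grid_verts n) = w"
        using fresh by (auto simp: fun_eq_iff restrict_def PiE_def extensional_def)
    qed
    show "\<forall>w\<in>words_ending k (Suc n) s. ?ext (restrict w (grid_verts n)) = w"
    proof
      fix w assume "w \<in> words_ending k (Suc n) s"
      then have "w \<in> grid_verts (Suc n) \<rightarrow>\<^sub>E {1..k}" "w (1, Suc n) = a" "w (2, Suc n) = b"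
        by (auto simp: words_ending_def grid_words_iff s)
      then show "?ext (restrict w (grid_verts n)) = w"
        unfolding verts by (auto simp: fun_eq_iff restrict_def PiE_def extensional_def)
    qed
    show "?ext ` ?A \<subseteq> words_ending k (Suc n) s"
    proof
      fix v assume "v \<in> ?ext ` ?A"
      then obtain w where w: "w \<in> ?A" and v: "v = ?ext w" by blast
      have wE: "w \<in> grid_verts n \<rightarrow>\<^sub>E {1..k}"
        and wc: "\<forall>j\<in>{1..n}. close (w (1, j)) (w (2, j))"
        and wr: "\<forall>j. 1 \<le> j \<longrightarrow> j < n \<longrightarrow> close (w (1, j)) (w (1, Suc j)) \<and> close (w (2, j)) (w (2, Suc j))"
        and wl: "n = 0 \<or> close (w (1, n)) a \<and> close (w (2, n)) b"
        using w by (auto simp: grid_words_iff nbrs_def s)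
      have "v \<in> grid_verts (Suc n) \<rightarrow>\<^sub>E {1..k}"
        unfolding v verts using ab by (intro PiE_fun_upd wE)
      moreover have "\<forall>j\<in>{1..Suc n}. close (v (1, j)) (v (2, j))"
        using wc ab by (auto simp: v le_Suc_eq)
      moreover have "\<forall>j. 1 \<le> j \<longrightarrow> j < Suc n \<longrightarrow> close (v (1, j)) (v (1, Suc j)) \<and> close (v (2, j)) (v (2, Suc j))"
        using wr wl by (auto simp: v less_Suc_eq)
      ultimately show "v \<in> words_ending k (Suc n) s"
        by (simp add: words_ending_def grid_words_iff s v)
    qed
    show "(\<lambda>w. restrict w (grid_verts n)) ` words_ending k (Suc n) s \<subseteq> ?A"
    proof
      fix v assume "v \<in> (\<lambda>w. restrict w (grid_verts n)) ` words_ending k (Suc n) s"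
      then obtain w where w: "w \<in> words_ending k (Suc n) s" and v: "v = restrict w (grid_verts n)"
        by blast
      have wE: "w \<in> grid_verts (Suc n) \<rightarrow>\<^sub>E {1..k}"
        and wc: "\<forall>j\<in>{1..Suc n}. close (w (1, j)) (w (2, j))"
        and wr: "\<forall>j. 1 \<le> j \<longrightarrow> j < Suc n \<longrightarrow> close (w (1, j)) (w (1, Suc j)) \<and> close (w (2, j)) (w (2, Suc j))"
        and wl: "w (1, Suc n) = a" "w (2, Suc n) = b"
        using w by (auto simp: words_ending_def grid_words_iff s)
      have vw: "v (i, j) = w (i, j)" if "i = 1 \<or> i = 2" "1 \<le> j" "j \<le> n" for i j
        using that by (auto simp: v grid_verts_def)
      have "v \<in> grid_verts n \<rightarrow>\<^sub>E {1..k}"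
        unfolding v using wE by (auto simp: verts dest: PiE_mem)
      then have v_words: "v \<in> grid_words k n"
        using wc wr by (auto simp: grid_words_iff vw)
      show "v \<in> ?A"
      proof (cases "n = 0")
        case False
        then have "(v (1, n), v (2, n)) \<in> states k"
          using last_column_states v_words by simp
        moreover have "close (v (1, n)) a" "close (v (2, n)) b"
          using False wr wl by (auto simp: vw)
        ultimately show ?thesis
          using v_words by (simp add: nbrs_def s)
      qed (use v_words in simp)
    qed
  qed
  then show ?thesis
    by (simp add: bij_betw_same_card)
qed

lemma card_words_ending_1:
  assumes "s \<in> states k"
  shows "card (words_ending k (Suc 0) s) = 1"
proof -
  have "grid_words k 0 = {\<lambda>_. undefined}"
    by (auto simp: staircase_words_def grid_verts_def)
  then show ?thesis
    using card_words_ending_Suc[OF assms, of 0] by simp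
qed

lemma card_words_ending_rec:
  assumes "s \<in> states k"
  shows "card (words_ending k (Suc (Suc n)) s) = (\<Sum>r\<in>nbrs k s. card (words_ending k (Suc n) r))"
proof -
  have "{r \<in> states k. r \<in> nbrs k s} = nbrs k s"
    by (auto simp: nbrs_def)
  then show ?thesis
    using card_words_ending_Suc[OF assms, of "Suc n"]
      card_grid_words_by_column[of "Suc n" k "\<lambda>r. r \<in> nbrs k s"] by simp
qed

lemma num_staircase_Suc:
  "num_staircase (grid_verts (Suc n)) grid_adj k = (\<Sum>s\<in>states k. card (words_ending k (Suc n) s))"
  using card_grid_words_by_column[of "Suc n" k "\<lambda>_. True"] by (simp add: num_staircase_def)

section \<open>Power series from solutions of the linear system\<close>

text \<open>The partial sums arise by iterating the equation for \<open>V\<close> from zero, and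
  each iteration multiplies the error bound by \<open>m * x < 1\<close>. Hence whatever solution
  \<open>V\<close> is supplied must be the limit, and convergence comes along with it.\<close>

lemma transfer_sums:
  fixes V :: "'a \<Rightarrow> real" and c :: "nat \<Rightarrow> 'a \<Rightarrow> real"
  assumes fin: "finite P" and N: "\<And>s. s \<in> P \<Longrightarrow> N s \<subseteq> P" "\<And>s. s \<in> P \<Longrightarrow> card (N s) \<le> m"
    and c0: "\<And>s. s \<in> P \<Longrightarrow> c 0 s = 1"
    and cS: "\<And>n s. s \<in> P \<Longrightarrow> c (Suc n) s = (\<Sum>r\<in>N s. c n r)"
    and V: "\<And>s. s \<in> P \<Longrightarrow> V s = x * (1 + (\<Sum>r\<in>N s. V r))"
    and x: "0 \<le> x" "real m * x < 1" and s: "s \<in> P"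
  shows "(\<lambda>n. c n s * x ^ Suc n) sums V s"
proof -
  \<comment> \<open>\<open>C\<close> bounds every \<open>V s\<close>, that is, the error of the
    empty partial sum.\<close>
  define C where "C = (\<Sum>r\<in>P. \<bar>V r\<bar>)"
  have C: "C \<ge> 0"
    by (simp add: C_def sum_nonneg)
  have bound: "\<bar>V s - (\<Sum>i<n. c i s * x ^ Suc i)\<bar> \<le> C * (real m * x) ^ n" if "s \<in> P" for s n
    using that
  proof (induction n arbitrary: s)
    case 0
    then show ?case
      using member_le_sum[of s P "\<lambda>r. \<bar>V r\<bar>"] fin by (simp add: C_def)
  next
    case (Suc n)
    \<comment> \<open>Splitting off the first term and unfolding \<open>cS\<close> shows that the
      partial sums obey the same equation as \<open>V\<close>, with one term fewer on the
      right.\<close>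
    have "(\<Sum>i<Suc n. c i s * x ^ Suc i) = x + (\<Sum>i<n. c (Suc i) s * x ^ Suc (Suc i))"
      using c0 Suc.prems by (subst sum.lessThan_Suc_shift) simp
    also have "(\<Sum>i<n. c (Suc i) s * x ^ Suc (Suc i)) = x * (\<Sum>i<n. \<Sum>r\<in>N s. c i r * x ^ Suc i)"
      unfolding cS[OF Suc.prems] by (simp add: sum_distrib_left sum_distrib_right algebra_simps)
    also have "(\<Sum>i<n. \<Sum>r\<in>N s. c i r * x ^ Suc i) = (\<Sum>r\<in>N s. \<Sum>i<n. c i r * x ^ Suc i)"
      by (rule sum.swap)
    finally have eq: "(\<Sum>i<Suc n. c i s * x ^ Suc i) = x + x * (\<Sum>r\<in>N s. \<Sum>i<n. c i r * x ^ Suc i)" .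
    have "V s - (\<Sum>i<Suc n. c i s * x ^ Suc i)
        = x * (1 + (\<Sum>r\<in>N s. V r)) - (x + x * (\<Sum>r\<in>N s. \<Sum>i<n. c i r * x ^ Suc i))"
      by (simp only: eq V[OF Suc.prems])
    also have "\<dots> = x * (\<Sum>r\<in>N s. V r - (\<Sum>i<n. c i r * x ^ Suc i))"
      unfolding sum_subtractf by algebra
    also have "\<bar>\<dots>\<bar> \<le> x * (\<Sum>r\<in>N s. \<bar>V r - (\<Sum>i<n. c i r * x ^ Suc i)\<bar>)"
      using x(1) by (simp add: abs_mult mult_left_mono)
    also have "\<dots> \<le> x * (real (card (N s)) * (C * (real m * x) ^ n))"
      using N(1)[OF Suc.prems] Suc.IH by (intro mult_left_mono sum_bounded_above x) auto
    also have "\<dots> \<le> x * (real m * (C * (real m * x) ^ n))"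
      using N(2)[OF Suc.prems] x C by (intro mult_left_mono mult_right_mono) auto
    finally show ?case
      by (simp add: algebra_simps)
  qed
  have "(\<lambda>n. C * (real m * x) ^ n) \<longlonglongrightarrow> C * 0"
    using x by (intro tendsto_intros LIMSEQ_power_zero) auto
  then have "(\<lambda>n. C * (real m * x) ^ n) \<longlonglongrightarrow> 0"
    by simp
  then have "(\<lambda>n. (\<Sum>i<n. c i s * x ^ Suc i) - V s) \<longlonglongrightarrow> 0"
    by (rule Lim_null_comparison[rotated], intro always_eventually allI)
      (simp only: real_norm_def, subst abs_minus_commute, rule bound[OF s])
  then show ?thesis
    unfolding sums_def by (rule LIM_zero_cancel)
qed

lemma staircase_gf_sums:
  fixes V :: "nat \<times> nat \<Rightarrow> real"
  assumes V: "\<And>s. s \<in> states k \<Longrightarrow> V s = x * (1 + (\<Sum>r\<in>nbrs k s. V r))"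
    and x: "0 \<le> x" "x < 1 / 9"
  shows "(\<lambda>n. fps_nth (staircase_gf k) n * x ^ n) sums (\<Sum>s\<in>states k. V s)"
proof -
  have "(\<lambda>n. real (card (words_ending k (Suc n) s)) * x ^ Suc n) sums V s" if "s \<in> states k" for s
    \<comment> \<open>Index \<open>n\<close> belongs to words with \<open>Suc n\<close> columns,
      hence the start value 1 for words with a single prescribed column.\<close>
    by (rule transfer_sums[where N = "nbrs k" and m = 9, OF finite_states nbrs_subset _ _ _ V _ _ that])
      (use x in \<open>auto simp: card_nbrs_le card_words_ending_1 card_words_ending_rec\<close>)
  then have "(\<lambda>n. \<Sum>s\<in>states k. real (card (words_ending k (Suc n) s)) * x ^ Suc n)
      sums (\<Sum>s\<in>states k. V s)"
    by (rule sums_sum)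
  then have "(\<lambda>n. fps_nth (staircase_gf k) (Suc n) * x ^ Suc n) sums (\<Sum>s\<in>states k. V s)"
    by (simp add: staircase_gf_def num_staircase_Suc sum_distrib_right)
  then show ?thesis
    \<comment> \<open>The coefficient at 0 vanishes, so the index shift changes nothing.\<close>
    by (subst (asm) sums_Suc_iff) (simp add: staircase_gf_def)
qed

section \<open>Reduction to a recurrence in one index\<close>

text \<open>The inhomogeneity \<open>c\<close> is kept as a parameter so that solutions can be superposed.\<close>

definition column_rec :: "real \<Rightarrow> real \<Rightarrow> (nat \<Rightarrow> real) \<Rightarrow> (nat \<Rightarrow> real) \<Rightarrow> bool" where
  "column_rec x c D E \<longleftrightarrow> (\<forall>i.
     D (Suc i) = x * (c + D i + D (Suc i) + D (Suc (Suc i)) + 2 * E i + 2 * E (Suc i)) \<and>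
     E (Suc i) = x * (c + D (Suc i) + D (Suc (Suc i)) + E i + 2 * E (Suc i) + E (Suc (Suc i))))"

context
  fixes k :: nat and D E :: "nat \<Rightarrow> real" and x :: real
  assumes rec: "column_rec x 1 D E"
    and bd: "D 0 = 0" "E 0 = 0" "D (Suc k) = 0" "E k = 0"
begin

text \<open>Swapping the two rows preserves the system, so the single sequence \<open>E\<close>
  serves both \<open>(i, Suc i)\<close> and \<open>(Suc i, i)\<close>.\<close>

definition state_val :: "nat \<times> nat \<Rightarrow> real" where
  "state_val s = (let (a, b) = s in
     if a = b then D a else if b = Suc a then E a else if a = Suc b then E b else 0)"

text \<open>\<open>?M\<close> is the neighbourhood when the range of letters is unbounded. At either
  end of the range, the members of \<open>?M\<close> outside \<open>states k\<close> get the value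
  \<open>D 0\<close>, \<open>E 0\<close>, \<open>E k\<close> or \<open>D (Suc k)\<close>, all zero,
  so the end columns follow the same recurrence as the others.\<close>

lemma sum_nbrs_diag:
  assumes "Suc i \<le> k"
  shows "(\<Sum>r\<in>nbrs k (Suc i, Suc i). state_val r) = D i + D (Suc i) + D (Suc (Suc i)) + 2 * E i + 2 * E (Suc i)"
proof -
  let ?M = "{(i, i), (i, Suc i), (Suc i, i), (Suc i, Suc i), (Suc i, Suc (Suc i)), (Suc (Suc i), Suc i), (Suc (Suc i), Suc (Suc i))}"
  have "(\<Sum>r\<in>nbrs k (Suc i, Suc i). state_val r) = (\<Sum>r\<in>?M. state_val r)"
  proof (rule sum.mono_neutral_left)
    show "nbrs k (Suc i, Suc i) \<subseteq> ?M"
    proof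
      fix r assume "r \<in> nbrs k (Suc i, Suc i)"
      then have "fst r = i \<or> fst r = Suc i \<or> fst r = Suc (Suc i)"
        "snd r = i \<or> snd r = Suc i \<or> snd r = Suc (Suc i)" "close (fst r) (snd r)"
        by (auto simp: nbrs_def states_def close_iff)
      then show "r \<in> ?M"
        by (cases r) (auto simp: close_iff)
    qed
    have top: "k = Suc i \<or> Suc (Suc i) \<le> k"
      using assms by auto
    show "\<forall>r\<in>?M - nbrs k (Suc i, Suc i). state_val r = 0"
    proof
      fix r assume "r \<in> ?M - nbrs k (Suc i, Suc i)"
      then have "r \<in> ?M" "r \<notin> nbrs k (Suc i, Suc i)"
        by blast+
      then show "state_val r = 0"
        using top bd assms by (cases "i = 0") (elim insertE disjE; simp add: nbrs_def states_def close_iff state_val_def)+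
    qed
  qed simp
  also have "\<dots> = D i + D (Suc i) + D (Suc (Suc i)) + 2 * E i + 2 * E (Suc i)"
    by (simp add: state_val_def)
  finally show ?thesis .
qed

text \<open>Only the two outermost members of \<open>?M\<close> can leave the range, and there they
  have value \<open>E 0\<close> or \<open>E k\<close>. The term \<open>2 * E (Suc i)\<close> comes
  from the column itself and its row swap.\<close>

lemma sum_nbrs_above:
  assumes "Suc (Suc i) \<le> k"
  shows "(\<Sum>r\<in>nbrs k (Suc i, Suc (Suc i)). state_val r) = D (Suc i) + D (Suc (Suc i)) + E i + 2 * E (Suc i) + E (Suc (Suc i))"
proof -
  let ?M = "{(i, Suc i), (Suc i, Suc i), (Suc i, Suc (Suc i)), (Suc (Suc i), Suc i), (Suc (Suc i), Suc (Suc i)), (Suc (Suc i), Suc (Suc (Suc i)))}"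
  have "(\<Sum>r\<in>nbrs k (Suc i, Suc (Suc i)). state_val r) = (\<Sum>r\<in>?M. state_val r)"
  proof (rule sum.mono_neutral_left)
    show "nbrs k (Suc i, Suc (Suc i)) \<subseteq> ?M"
    proof
      fix r assume "r \<in> nbrs k (Suc i, Suc (Suc i))"
      then have "fst r = i \<or> fst r = Suc i \<or> fst r = Suc (Suc i)"
        "snd r = Suc i \<or> snd r = Suc (Suc i) \<or> snd r = Suc (Suc (Suc i))" "close (fst r) (snd r)"
        by (auto simp: nbrs_def states_def close_iff)
      then show "r \<in> ?M"
        by (cases r) (auto simp: close_iff)
    qed
    have top: "k = Suc (Suc i) \<or> Suc (Suc (Suc i)) \<le> k"
      using assms by auto
    show "\<forall>r\<in>?M - nbrs k (Suc i, Suc (Suc i)). state_val r = 0"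
    proof
      fix r assume "r \<in> ?M - nbrs k (Suc i, Suc (Suc i))"
      then have "r \<in> ?M" "r \<notin> nbrs k (Suc i, Suc (Suc i))"
        by blast+
      then show "state_val r = 0"
        using top bd assms by (cases "i = 0") (elim insertE disjE; simp add: nbrs_def states_def close_iff state_val_def)+
    qed
  qed simp
  also have "\<dots> = D (Suc i) + D (Suc (Suc i)) + E i + 2 * E (Suc i) + E (Suc (Suc i))"
    by (simp add: state_val_def)
  finally show ?thesis .
qed

lemma sum_nbrs_below:
  assumes "Suc (Suc i) \<le> k"
  shows "(\<Sum>r\<in>nbrs k (Suc (Suc i), Suc i). state_val r) = D (Suc i) + D (Suc (Suc i)) + E i + 2 * E (Suc i) + E (Suc (Suc i))"
proof -
  let ?M = "{(Suc i, i), (Suc i, Suc i), (Suc i, Suc (Suc i)), (Suc (Suc i), Suc i), (Suc (Suc i), Suc (Suc i)), (Suc (Suc (Suc i)), Suc (Suc i))}"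
  have "(\<Sum>r\<in>nbrs k (Suc (Suc i), Suc i). state_val r) = (\<Sum>r\<in>?M. state_val r)"
  proof (rule sum.mono_neutral_left)
    show "nbrs k (Suc (Suc i), Suc i) \<subseteq> ?M"
    proof
      fix r assume "r \<in> nbrs k (Suc (Suc i), Suc i)"
      then have "fst r = Suc i \<or> fst r = Suc (Suc i) \<or> fst r = Suc (Suc (Suc i))"
        "snd r = i \<or> snd r = Suc i \<or> snd r = Suc (Suc i)" "close (fst r) (snd r)"
        by (auto simp: nbrs_def states_def close_iff)
      then show "r \<in> ?M"
        by (cases r) (auto simp: close_iff)
    qed
    have top: "k = Suc (Suc i) \<or> Suc (Suc (Suc i)) \<le> k"
      using assms by auto
    show "\<forall>r\<in>?M - nbrs k (Suc (Suc i), Suc i). state_val r = 0"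
    proof
      fix r assume "r \<in> ?M - nbrs k (Suc (Suc i), Suc i)"
      then have "r \<in> ?M" "r \<notin> nbrs k (Suc (Suc i), Suc i)"
        by blast+
      then show "state_val r = 0"
        using top bd assms by (cases "i = 0") (elim insertE disjE; simp add: nbrs_def states_def close_iff state_val_def)+
    qed
  qed simp
  also have "\<dots> = D (Suc i) + D (Suc (Suc i)) + E i + 2 * E (Suc i) + E (Suc (Suc i))"
    by (simp add: state_val_def)
  finally show ?thesis .
qed

lemma state_val_transfer:
  assumes s: "s \<in> states k"
  shows "state_val s = x * (1 + (\<Sum>r\<in>nbrs k s. state_val r))"
proof -
  obtain a b where ab: "s = (a, b)" by (cases s)
  have "close a b" "1 \<le> a" "1 \<le> b" "a \<le> k" "b \<le> k"
    using s by (auto simp: ab states_def)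
  then obtain i j where ij: "s = (Suc i, Suc j)" "Suc i \<le> k" "Suc j \<le> k"
    and "j = i \<or> j = Suc i \<or> i = Suc j"
    by (cases a; cases b) (auto simp: ab close_iff)
  then consider "j = i" | "j = Suc i" | "i = Suc j"
    by blast
  then show ?thesis
  proof cases
    case 1
    have "state_val s = D (Suc i)" "(\<Sum>r\<in>nbrs k s. state_val r)
        = D i + D (Suc i) + D (Suc (Suc i)) + 2 * E i + 2 * E (Suc i)"
      using sum_nbrs_diag[OF ij(2)] by (simp_all add: ij 1 state_val_def)
    then show ?thesis
      using rec[unfolded column_rec_def, rule_format, of i] by (simp only: add.assoc)
  next
    case 2
    have "state_val s = E (Suc i)" "(\<Sum>r\<in>nbrs k s. state_val r)
        = D (Suc i) + D (Suc (Suc i)) + E i + 2 * E (Suc i) + E (Suc (Suc i))"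
      using sum_nbrs_above[OF ij(3)[unfolded 2]] by (simp_all add: ij 2 state_val_def)
    then show ?thesis
      using rec[unfolded column_rec_def, rule_format, of i] by (simp only: add.assoc)
  next
    case 3
    have "state_val s = E (Suc j)" "(\<Sum>r\<in>nbrs k s. state_val r)
        = D (Suc j) + D (Suc (Suc j)) + E j + 2 * E (Suc j) + E (Suc (Suc j))"
      using sum_nbrs_below[OF ij(2)[unfolded 3]] by (simp_all add: ij 3 state_val_def)
    then show ?thesis
      using rec[unfolded column_rec_def, rule_format, of j] by (simp only: add.assoc)
  qed
qed

lemma sum_state_val:
  "(\<Sum>s\<in>states k. state_val s) = (\<Sum>i=1..k. D i) + 2 * (\<Sum>i=1..k. E i)"
proof -
  let ?d = "(\<lambda>i::nat. (i, i)) ` {1..k}" and ?u = "(\<lambda>i. (i, Suc i)) ` {1..<k}"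
    and ?l = "(\<lambda>i. (Suc i, i)) ` {1..<k}"
  have "states k = ?d \<union> (?u \<union> ?l)"
  proof (rule set_eqI)
    fix s
    show "s \<in> states k \<longleftrightarrow> s \<in> ?d \<union> (?u \<union> ?l)"
      by (cases s) (auto simp: states_def close_iff)
  qed
  moreover have "?d \<inter> (?u \<union> ?l) = {}" "?u \<inter> ?l = {}"
    by auto
  ultimately have "(\<Sum>s\<in>states k. state_val s) = sum state_val ?d + (sum state_val ?u + sum state_val ?l)"
    by (simp add: sum.union_disjoint)
  also have "sum state_val ?d = (\<Sum>i=1..k. D i)"
    by (subst sum.reindex) (auto simp: inj_on_def state_val_def)
  also have "sum state_val ?u = (\<Sum>i=1..<k. E i)"
    by (subst sum.reindex) (auto simp: inj_on_def state_val_def)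
  also have "sum state_val ?l = (\<Sum>i=1..<k. E i)"
    by (subst sum.reindex) (auto simp: inj_on_def state_val_def)
  \<comment> \<open>Off-diagonal columns stop at index \<open>k - 1\<close>; the added summand is
    \<open>E k = 0\<close>.\<close>
  also have "(\<Sum>i=1..<k. E i) = (\<Sum>i=1..k. E i)"
    using bd by (intro sum.mono_neutral_left) (auto simp: not_less le_less)
  finally show ?thesis by simp
qed

lemma staircase_gf_sums_from_recurrence:
  assumes "0 \<le> x" "x < 1 / 9"
  shows "(\<lambda>n. fps_nth (staircase_gf k) n * x ^ n) sums ((\<Sum>i=1..k. D i) + 2 * (\<Sum>i=1..k. E i))"
  using staircase_gf_sums[OF state_val_transfer assms] by (simp add: sum_state_val)

end

section \<open>Superposition, the constant solution and geometric modes\<close>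

lemma column_rec_add:
  assumes "column_rec x c D E" "column_rec x c' D' E'"
  shows "column_rec x (c + c') (\<lambda>i. D i + D' i) (\<lambda>i. E i + E' i)"
  unfolding column_rec_def
proof (intro allI conjI)
  fix i
  show "D (Suc i) + D' (Suc i) = x * (c + c' + (D i + D' i) + (D (Suc i) + D' (Suc i))
      + (D (Suc (Suc i)) + D' (Suc (Suc i))) + 2 * (E i + E' i) + 2 * (E (Suc i) + E' (Suc i)))"
    using assms[unfolded column_rec_def, rule_format, of i] by algebra
  show "E (Suc i) + E' (Suc i) = x * (c + c' + (D (Suc i) + D' (Suc i))
      + (D (Suc (Suc i)) + D' (Suc (Suc i))) + (E i + E' i) + 2 * (E (Suc i) + E' (Suc i))
      + (E (Suc (Suc i)) + E' (Suc (Suc i))))"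
    using assms[unfolded column_rec_def, rule_format, of i] by algebra
qed

lemma column_rec_scale:
  assumes "column_rec x c D E"
  shows "column_rec x (b * c) (\<lambda>i. b * D i) (\<lambda>i. b * E i)"
  unfolding column_rec_def
proof (intro allI conjI)
  fix i
  show "b * D (Suc i) = x * (b * c + b * D i + b * D (Suc i)
      + b * D (Suc (Suc i)) + 2 * (b * E i) + 2 * (b * E (Suc i)))"
    using assms[unfolded column_rec_def, rule_format, of i] by algebra
  show "b * E (Suc i) = x * (b * c + b * D (Suc i)
      + b * D (Suc (Suc i)) + b * E i + 2 * (b * E (Suc i)) + b * E (Suc (Suc i)))"
    using assms[unfolded column_rec_def, rule_format, of i] by algebra
qed

text \<open>For constant sequences the recurrence becomes
  \<open>D = x * (1 + 3 * D + 4 * E)\<close>, \<open>E = x * (1 + 2 * D + 4 * E)\<close>, a linear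
  system with determinant \<open>4 * x^2 - 7 * x + 1\<close>.\<close>

lemma column_rec_const:
  assumes "4 * x^2 - 7 * x + 1 \<noteq> 0"
  shows "column_rec x 1 (\<lambda>_. x / (4 * x^2 - 7 * x + 1)) (\<lambda>_. x * (1 - x) / (4 * x^2 - 7 * x + 1))"
proof -
  define w where "w = x / (4 * x^2 - 7 * x + 1)"
  have w: "w * (4 * x^2 - 7 * x + 1) = x"
    using assms by (simp add: w_def)
  have "x * (1 - x) / (4 * x^2 - 7 * x + 1) = w * (1 - x)"
    by (simp add: w_def)
  then show ?thesis
    unfolding column_rec_def w_def[symmetric] by (auto, (use w in algebra)+)
qed

text \<open>Here \<open>s\<close> is \<open>t + 1 / t\<close>. Inserting the geometric ansatz and
  dividing the \<open>E\<close>-equation by \<open>t * (1 + t)\<close> and the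
  \<open>D\<close>-equation by \<open>t\<close> leaves the conditions on \<open>h\<close> and
  \<open>s\<close>, in which \<open>t\<close> occurs only through \<open>s\<close>.\<close>

lemma column_rec_mode:
  fixes x s h t :: real
  assumes t: "t * t = s * t - 1" and h: "h * (1 - x * (2 + s)) = x"
    and s: "x * (1 + s) + 2 * x * h * (2 + s) = 1"
  shows "column_rec x 0 (\<lambda>i. t ^ i) (\<lambda>i. h * (1 + t) * t ^ i)"
proof -
  have "t = x * (1 + t + t * t + 2 * h * ((1 + t) * (1 + t)))"
    "h * (1 + t) * t = x * (t * (1 + t) + h * (1 + t) * ((1 + t) * (1 + t)))"
    using assms by algebra+
  \<comment> \<open>The factor \<open>z\<close> is later instantiated with \<open>t ^ i\<close>,
    carrying the case \<open>i = 0\<close> to every index.\<close>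
  then have "t * z = x * (0 + z + t * z + t * (t * z) + 2 * (h * (1 + t) * z) + 2 * (h * (1 + t) * (t * z)))"
    "h * (1 + t) * (t * z) = x * (0 + t * z + t * (t * z) + h * (1 + t) * z + 2 * (h * (1 + t) * (t * z))
        + h * (1 + t) * (t * (t * z)))" for z
    by algebra+
  then show ?thesis
    unfolding column_rec_def power_Suc by blast
qed

lemma sum_geometric_Suc:
  fixes t :: real
  assumes "t \<noteq> 1"
  shows "(\<Sum>i=1..k. t ^ i) = t * (t ^ k - 1) / (t - 1)"
  using assms by (induction k) (auto simp: field_simps)

lemma sum_geometric_inverse:
  fixes t :: real
  assumes "t \<noteq> 1" "t \<noteq> 0"
  shows "(\<Sum>i=1..k. (1 / t) ^ i) = (1 - 1 / t ^ k) / (t - 1)"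
proof (induction k)
  case (Suc k)
  have "(1 - 1 / t ^ k) / (t - 1) + (1 / t) ^ Suc k = (1 - 1 / t ^ Suc k) / (t - 1)"
    using assms by (simp add: field_simps)
  then show ?case
    using Suc by simp
qed simp

section \<open>Algebraic identities between the kernel roots\<close>

text \<open>
  The two possible values of \<open>t + 1 / t\<close> are \<open>y + e\<close> and \<open>y - 1 - e\<close>, where \<open>y = 1 / x\<close> and
  \<open>e = (sqrt (x * (9 * x + 8)) / x - 1) / 2\<close>.  With these parameters every polynomial identity between
  \<open>x\<close>, \<open>t\<^sub>1 = p\<close> and \<open>t\<^sub>2 = q\<close> can be checked by lowering the degrees in \<open>e\<close>, \<open>p\<close> and \<open>q\<close> below two.
\<close>

locale kernel_roots =
  fixes x y e p q :: real
  assumes xy: "x * y = 1"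
    and ee: "e * e = 2 * y + 2 - e"
    and pp: "p * p = (y + e) * p - 1"
    and qq: "q * q = (y - 1 - e) * q - 1"
    and x_pos: "x > 0" and e_gt_1: "e > 1" and p_gt_1: "p > 1" and q_gt_1: "q > 1"
    and disc_ne: "4 * x^2 - 7 * x + 1 \<noteq> 0"
begin

text \<open>\<open>algebra_simps\<close> nests products to the right and may hide a square as
  \<open>e * (e * z)\<close>; these forms let the simplifier reduce it there too.\<close>

lemma left_reduce: "e * (e * z) = (2 * y + 2 - e) * z" "p * (p * z) = ((y + e) * p - 1) * z"
  "q * (q * z) = ((y - 1 - e) * q - 1) * z"
  using ee pp qq by (metis mult.assoc)+

lemmas reduce = ee pp qq left_reduce

lemma e_factor: "(2 + e) * (1 - e) = - 2 * y"
  using ee by (simp add: algebra_simps)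

text \<open>Up to \<open>p * q * x\<close>, the right-hand sides are the coefficients of
  \<open>T * U\<close>, \<open>T\<close>, \<open>U\<close> and 1 in \<open>(1 + q) * (2 + e) * (1 +
  U) * (1 + p * T) - (1 + p) * (1 - e) * (1 + T) * (1 + q * U)\<close>, a multiple of the
  determinant of the boundary conditions.\<close>

lemma b_factor:
  "b1 x p q = p * q * x * ((1 + q) * (2 + e) * p - (1 + p) * (1 - e) * q)"
  "b2 x p q = p * q * x * ((1 + q) * (2 + e) * p - (1 + p) * (1 - e))"
  "- b2 x q p = p * q * x * ((1 + q) * (2 + e) - (1 + p) * (1 - e) * q)"
  "b3 x p q = p * q * x * ((1 + q) * (2 + e) - (1 + p) * (1 - e))"
proof -
  have "(1 + q) * (2 + e) * p - (1 + p) * (1 - e) * q = (p - q) * ((p + 1) * (q + 1) - y)"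
    by (simp add: algebra_simps reduce)
  moreover have "b1 x p q = p * q * x * ((p - q) * ((p + 1) * (q + 1) - y))"
    unfolding b1_def using xy by algebra
  ultimately show "b1 x p q = p * q * x * ((1 + q) * (2 + e) * p - (1 + p) * (1 - e) * q)"
    by simp
  have "q * ((1 + q) * (2 + e) * p - (1 + p) * (1 - e)) = (p * q - 1) * ((p + 1) * (q + 1) - q * y)"
    by (simp add: algebra_simps reduce)
  moreover have "b2 x p q = p * x * ((p * q - 1) * ((p + 1) * (q + 1) - q * y))"
    unfolding b2_def using xy by algebra
  ultimately show "b2 x p q = p * q * x * ((1 + q) * (2 + e) * p - (1 + p) * (1 - e))"
    by simp
  have "p * ((1 + q) * (2 + e) - (1 + p) * (1 - e) * q) = - (p * q - 1) * ((p + 1) * (q + 1) - p * y)"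
    by (simp add: algebra_simps reduce)
  moreover have "- b2 x q p = q * x * (- (p * q - 1) * ((p + 1) * (q + 1) - p * y))"
    unfolding b2_def using xy by algebra
  ultimately show "- b2 x q p = p * q * x * ((1 + q) * (2 + e) - (1 + p) * (1 - e) * q)"
    by (metis mult.assoc mult.commute)
  have "p * q * ((1 + q) * (2 + e) - (1 + p) * (1 - e)) = (q - p) * ((p + 1) * (q + 1) - p * q * y)"
    by (simp add: algebra_simps reduce)
  moreover have "b3 x p q = x * ((q - p) * ((p + 1) * (q + 1) - p * q * y))"
    unfolding b3_def using xy by algebra
  ultimately show "b3 x p q = p * q * x * ((1 + q) * (2 + e) - (1 + p) * (1 - e))"
    by (metis mult.assoc mult.commute)
qed

text \<open>The part linear in \<open>k\<close> stems from the constant solution: \<open>w\<close>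
  is \<open>(p - 1) * (q - 1)\<close> times the numerator of \<open>D + 2 * E\<close> for that
  solution. The rest regroups into the Cramer numerators of the mode amplitudes.\<close>

lemma a_factor:
  fixes k :: real
  defines "w \<equiv> (p - 1) * (q - 1) * x * (3 - 2 * x)"
  shows "a1 k x p q = k * w * b1 x p q + 2 * p * q * x *
      (((1 - x) * (1 - e) * q + (1 + q)) * p * (q - 1) - ((1 - x) * (2 + e) * p + (1 + p)) * q * (p - 1))"
    and "a2 k x p q = k * w * b2 x p q + 2 * p * q * x *
      (((1 - x) * (1 - e) + (1 + q)) * p * (q - 1) + ((1 - x) * (2 + e) * p + (1 + p)) * q * (p - 1))"
    and "- a2 k x q p = k * w * (- b2 x q p) - 2 * p * q * x *
      (((1 - x) * (1 - e) * q + (1 + q)) * p * (q - 1) + ((1 - x) * (2 + e) + (1 + p)) * q * (p - 1))"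
    and "a3 k x p q = k * w * b3 x p q - 2 * p * q * x *
      (((1 - x) * (1 - e) + (1 + q)) * p * (q - 1) - ((1 - x) * (2 + e) + (1 + p)) * q * (p - 1))"
proof -
  have k1: "a1 k x p q = k * w * b1 x p q + a1 0 x p q"
    and k2: "a2 k x p q = k * w * b2 x p q + a2 0 x p q"
    and k2': "- a2 k x q p = k * w * (- b2 x q p) - a2 0 x q p"
    and k3: "a3 k x p q = k * w * b3 x p q + a3 0 x p q"
    unfolding w_def a1_def a2_def a3_def b1_def b2_def b3_def by algebra+
  \<comment> \<open>Extracting \<open>x^2\<close> turns the remaining powers of \<open>x\<close>
    into powers of \<open>y = 1 / x\<close>, so only an identity in \<open>y\<close>,
    \<open>e\<close>, \<open>p\<close>, \<open>q\<close> is left, which \<open>reduce\<close>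
    decides. The other three cases follow the same pattern.\<close>
  have "(q - p) * ((- 2*p^2*q - 2*p*q^2 - 2*p*q - 2) + (2*p^2*q + 2*p*q^2 + 6*p*q + 4) * y - 2*q*p*y^2)
    = 2 * ((y - 1) * p * q * ((1 - e) * (q - 1) - (2 + e) * (p - 1))
        + y * (p * ((1 + q) * (q - 1)) - q * ((1 + p) * (p - 1))))"
    by (simp add: algebra_simps reduce power2_eq_square)
  moreover have "a1 0 x p q = p * q * x^2 * ((q - p) *
      ((- 2*p^2*q - 2*p*q^2 - 2*p*q - 2) + (2*p^2*q + 2*p*q^2 + 6*p*q + 4) * y - 2*q*p*y^2))"
    unfolding a1_def using xy by algebra
  ultimately have "a1 0 x p q = 2 * p * q * (x^2 * (y - 1) * p * q * ((1 - e) * (q - 1) - (2 + e) * (p - 1))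
        + x^2 * y * (p * ((1 + q) * (q - 1)) - q * ((1 + p) * (p - 1))))"
    by algebra
  then show "a1 k x p q = k * w * b1 x p q + 2 * p * q * x *
      (((1 - x) * (1 - e) * q + (1 + q)) * p * (q - 1) - ((1 - x) * (2 + e) * p + (1 + p)) * q * (p - 1))"
    unfolding k1 using xy by algebra
  have "(1 - p*q) * ((2*p^2*q + 2*p*q + 2*q^2 + 2*p) + (- 2*p^2*q - 6*p*q - 4*q^2 - 2*p) * y + 2*q*p*y^2)
    = 2 * q * ((y - 1) * p * ((1 - e) * (q - 1) + (2 + e) * q * (p - 1))
        + y * (p * ((1 + q) * (q - 1)) + q * ((1 + p) * (p - 1))))"
    by (simp add: algebra_simps reduce power2_eq_square)
  moreover have "a2 0 x p q = p * x^2 * ((1 - p*q) *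
      ((2*p^2*q + 2*p*q + 2*q^2 + 2*p) + (- 2*p^2*q - 6*p*q - 4*q^2 - 2*p) * y + 2*q*p*y^2))"
    unfolding a2_def using xy by algebra
  ultimately have "a2 0 x p q = 2 * p * q * (x^2 * (y - 1) * p * ((1 - e) * (q - 1) + (2 + e) * q * (p - 1))
        + x^2 * y * (p * ((1 + q) * (q - 1)) + q * ((1 + p) * (p - 1))))"
    by algebra
  then show "a2 k x p q = k * w * b2 x p q + 2 * p * q * x *
      (((1 - x) * (1 - e) + (1 + q)) * p * (q - 1) + ((1 - x) * (2 + e) * p + (1 + p)) * q * (p - 1))"
    unfolding k2 using xy by algebra
  have "(1 - q*p) * ((2*q^2*p + 2*q*p + 2*p^2 + 2*q) + (- 2*q^2*p - 6*q*p - 4*p^2 - 2*q) * y + 2*p*q*y^2)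
    = 2 * p * ((y - 1) * q * ((1 - e) * p * (q - 1) + (2 + e) * (p - 1))
        + y * (p * ((1 + q) * (q - 1)) + q * ((1 + p) * (p - 1))))"
    by (simp add: algebra_simps reduce power2_eq_square)
  moreover have "a2 0 x q p = q * x^2 * ((1 - q*p) *
      ((2*q^2*p + 2*q*p + 2*p^2 + 2*q) + (- 2*q^2*p - 6*q*p - 4*p^2 - 2*q) * y + 2*p*q*y^2))"
    unfolding a2_def using xy by algebra
  ultimately have "a2 0 x q p = 2 * p * q * (x^2 * (y - 1) * q * ((1 - e) * p * (q - 1) + (2 + e) * (p - 1))
        + x^2 * y * (p * ((1 + q) * (q - 1)) + q * ((1 + p) * (p - 1))))"
    by algebra
  then show "- a2 k x q p = k * w * (- b2 x q p) - 2 * p * q * x *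
      (((1 - x) * (1 - e) * q + (1 + q)) * p * (q - 1) + ((1 - x) * (2 + e) + (1 + p)) * q * (p - 1))"
    unfolding k2' using xy by algebra
  have "(p - q) * ((- 2*p^2*q^2 - 2*p*q - 2*p - 2*q) + (4*p^2*q^2 + 6*p*q + 2*p + 2*q) * y - 2*p*q*y^2)
    = - 2 * p * q * ((y - 1) * (p * (1 - e) * (q - 1) - q * (2 + e) * (p - 1))
        + y * (p * ((1 + q) * (q - 1)) - q * ((1 + p) * (p - 1))))"
    by (simp add: algebra_simps reduce power2_eq_square)
  moreover have "a3 0 x p q = x^2 * ((p - q) *
      ((- 2*p^2*q^2 - 2*p*q - 2*p - 2*q) + (4*p^2*q^2 + 6*p*q + 2*p + 2*q) * y - 2*p*q*y^2))"
    unfolding a3_def using xy by algebra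
  ultimately have "a3 0 x p q = - 2 * p * q * (x^2 * (y - 1) * (p * (1 - e) * (q - 1) - q * (2 + e) * (p - 1))
        + x^2 * y * (p * ((1 + q) * (q - 1)) - q * ((1 + p) * (p - 1))))"
    by algebra
  then show "a3 k x p q = k * w * b3 x p q - 2 * p * q * x *
      (((1 - x) * (1 - e) + (1 + q)) * p * (q - 1) - ((1 - x) * (2 + e) + (1 + p)) * q * (p - 1))"
    unfolding k3 using xy by algebra
qed

section \<open>Modes, Cramer's rule and the summed solution\<close>

text \<open>The ratios of the \<open>E\<close>-amplitude to the \<open>D\<close>-amplitude in the modes \<open>p\<^sup>i\<close> and \<open>q\<^sup>i\<close>.\<close>

definition g1 where "g1 = x * (1 - e) / 2 * (1 + p)"
definition g2 where "g2 = x * (2 + e) / 2 * (1 + q)"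

lemma column_rec_modes:
  "column_rec x 0 (\<lambda>i. p ^ i) (\<lambda>i. g1 * p ^ i)"
  "column_rec x 0 (\<lambda>i. (1 / p) ^ i) (\<lambda>i. g1 / p * (1 / p) ^ i)"
  "column_rec x 0 (\<lambda>i. q ^ i) (\<lambda>i. g2 * q ^ i)"
  "column_rec x 0 (\<lambda>i. (1 / q) ^ i) (\<lambda>i. g2 / q * (1 / q) ^ i)"
proof -
  \<comment> \<open>The quadratics are reciprocal, so inverse roots have the same value of
    \<open>t + 1 / t\<close>.\<close>
  have inv: "1 / p * (1 / p) = (y + e) * (1 / p) - 1" "1 / q * (1 / q) = (y - 1 - e) * (1 / q) - 1"
    using pp qq p_gt_1 q_gt_1 by (simp_all add: field_simps)
  \<comment> \<open>Replacing \<open>e\<close> by \<open>- 1 - e\<close> exchanges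
    \<open>y + e\<close> with \<open>y - 1 - e\<close> and \<open>1 - e\<close> with
    \<open>2 + e\<close>, hence the statements for \<open>p\<close> with those for
    \<open>q\<close>.\<close>
  have hp: "x * (1 - e) / 2 * (1 - x * (2 + (y + e))) = x"
    "x * (1 + (y + e)) + 2 * x * (x * (1 - e) / 2) * (2 + (y + e)) = 1"
    and hq: "x * (2 + e) / 2 * (1 - x * (2 + (y - 1 - e))) = x"
    "x * (1 + (y - 1 - e)) + 2 * x * (x * (2 + e) / 2) * (2 + (y - 1 - e)) = 1"
    using xy ee by algebra+
  have gi: "g1 / p = x * (1 - e) / 2 * (1 + 1 / p)" "g2 / q = x * (2 + e) / 2 * (1 + 1 / q)"
    using p_gt_1 q_gt_1 by (simp_all add: g1_def g2_def field_simps)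
  show "column_rec x 0 (\<lambda>i. p ^ i) (\<lambda>i. g1 * p ^ i)"
    unfolding g1_def by (rule column_rec_mode[OF pp hp])
  show "column_rec x 0 (\<lambda>i. (1 / p) ^ i) (\<lambda>i. g1 / p * (1 / p) ^ i)"
    unfolding gi by (rule column_rec_mode[OF inv(1) hp])
  show "column_rec x 0 (\<lambda>i. q ^ i) (\<lambda>i. g2 * q ^ i)"
    unfolding g2_def by (rule column_rec_mode[OF qq hq])
  show "column_rec x 0 (\<lambda>i. (1 / q) ^ i) (\<lambda>i. g2 / q * (1 / q) ^ i)"
    unfolding gi by (rule column_rec_mode[OF inv(2) hq])
qed

text \<open>The powers \<open>p ^ k\<close> and \<open>q ^ k\<close> of the final formula become
  free variables \<open>T\<close> and \<open>U\<close>, so that \<open>num\<close> and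
  \<open>den\<close> can be treated as polynomials in them.\<close>

definition num :: "real \<Rightarrow> real \<Rightarrow> real \<Rightarrow> real" where
  "num k T U = a1 k x p q * T * U + a2 k x p q * T - a2 k x q p * U + a3 k x p q"

definition den :: "real \<Rightarrow> real \<Rightarrow> real" where
  "den T U = b1 x p q * T * U + b2 x p q * T - b2 x q p * U + b3 x p q"

lemma den_eq:
  "den T U = 2 * p * q * (g2 * (1 + U) * (1 + p * T) - g1 * (1 + T) * (1 + q * U))"
proof -
  have g: "2 * g1 = x * (1 - e) * (1 + p)" "2 * g2 = x * (2 + e) * (1 + q)"
    by (simp_all add: g1_def g2_def)
  have "den T U = b1 x p q * T * U + b2 x p q * T + (- b2 x q p) * U + b3 x p q"
    by (simp add: den_def)
  also have "\<dots> = p * q * ((x * (2 + e) * (1 + q)) * (1 + U) * (1 + p * T)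
      - (x * (1 - e) * (1 + p)) * (1 + T) * (1 + q * U))"
    unfolding b_factor by algebra
  also have "\<dots> = 2 * p * q * (g2 * (1 + U) * (1 + p * T) - g1 * (1 + T) * (1 + q * U))"
    unfolding g[symmetric] by algebra
  finally show ?thesis .
qed

text \<open>Because \<open>e > 1\<close>, the ratio \<open>g1\<close> is negative while
  \<open>g2\<close> is positive, so the two products in \<open>den_eq\<close> cannot cancel.\<close>

lemma den_pos:
  assumes "T > 0" "U > 0"
  shows "den T U > 0"
proof -
  have "g1 < 0" "g2 > 0"
    using x_pos e_gt_1 p_gt_1 q_gt_1 by (auto simp: g1_def g2_def mult_less_0_iff)
  then have "g2 * (1 + U) * (1 + p * T) > 0" "g1 * (1 + T) * (1 + q * U) < 0"
    using p_gt_1 q_gt_1 assms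
    by (auto intro!: mult_pos_pos mult_neg_pos add_pos_pos)
  then show ?thesis
    unfolding den_eq using p_gt_1 q_gt_1 by (intro mult_pos_pos) auto
qed

text \<open>The brackets are the Cramer numerators for the amplitudes of the modes. The relation
  \<open>e_factor\<close> gives \<open>g2 * (1 - e) = - (1 + q)\<close> and
  \<open>g1 * (2 + e) = - (1 + p)\<close>, which matches them with \<open>a_factor\<close>.\<close>

lemma num_eq:
  "num k T U = k * ((p - 1) * (q - 1) * x * (3 - 2 * x)) * den T U + 2 * p * q * x *
     (((1 - x) * (1 + q * U) - g2 * (1 + U)) * (1 - e) * p * (T - 1) * (q - 1)
      - ((1 - x) * (1 + p * T) - g1 * (1 + T)) * (2 + e) * q * (U - 1) * (p - 1))"
proof -
  have num': "num k T U = a1 k x p q * T * U + a2 k x p q * T + (- a2 k x q p) * U + a3 k x p q"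
    by (simp add: num_def)
  have "2 * g1 = x * (1 - e) * (1 + p)" "2 * g2 = x * (2 + e) * (1 + q)"
    by (simp_all add: g1_def g2_def)
  then have "2 * (g2 * (1 - e)) = 2 * - (1 + q)" "2 * (g1 * (2 + e)) = 2 * - (1 + p)"
    using xy e_factor by algebra+
  then have g: "g2 * (1 - e) = - (1 + q)" "g1 * (2 + e) = - (1 + p)"
    by simp_all
  have "((1 - x) * (1 + q * U) - g2 * (1 + U)) * (1 - e) = (1 - x) * (1 - e) * (1 + q * U) + (1 + q) * (1 + U)"
    "((1 - x) * (1 + p * T) - g1 * (1 + T)) * (2 + e) = (1 - x) * (2 + e) * (1 + p * T) + (1 + p) * (1 + T)"
    using g by algebra+
  note brackets = this
  have "num k T U = k * ((p - 1) * (q - 1) * x * (3 - 2 * x)) * den T U + 2 * p * q * x *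
     (((1 - x) * (1 - e) * (1 + q * U) + (1 + q) * (1 + U)) * p * (T - 1) * (q - 1)
      - ((1 - x) * (2 + e) * (1 + p * T) + (1 + p) * (1 + T)) * q * (U - 1) * (p - 1))"
    unfolding num' a_factor den_def by algebra
  then show ?thesis
    unfolding brackets[symmetric] .
qed

text \<open>In the sum of \<open>D + 2 * E\<close>, these terms join \<open>2 * p\<close> and
  \<open>2 * q\<close> from the diagonal columns, leaving the weights \<open>(1 - e) * p\<close> and
  \<open>(2 + e) * q\<close>.\<close>

lemma g_square: "2 * (g1 * (1 + p)) = - (1 + e) * p" "2 * (g2 * (1 + q)) = e * q"
  unfolding g1_def g2_def using xy ee pp qq by algebra+

lemma explicit_solution:
  obtains D E where "column_rec x 1 D E" "D 0 = 0" "E 0 = 0" "D (Suc k) = 0" "E k = 0"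
    "(\<Sum>i=1..k. D i) + 2 * (\<Sum>i=1..k. E i) = num (real k) (p ^ k) (q ^ k) / ((p - 1) * (q - 1) * (4 * x^2 - 7 * x + 1) * den (p ^ k) (q ^ k))"
proof -
  define d h where "d = x / (4 * x^2 - 7 * x + 1)" and "h = x * (1 - x) / (4 * x^2 - 7 * x + 1)"
  define T U where "T = p ^ k" and "U = q ^ k"
  \<comment> \<open>\<open>A\<close> and \<open>B\<close> solve, by Cramer's rule, the two equations
    that express \<open>D 0 = 0\<close> and \<open>E 0 = 0\<close>.\<close>
  define A where "A = 2 * p * q * (h * (1 + q * U) - d * g2 * (1 + U)) / den (p ^ k) (q ^ k)"
  define B where "B = - 2 * p * q * (h * (1 + p * T) - d * g1 * (1 + T)) / den (p ^ k) (q ^ k)"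
  \<comment> \<open>As \<open>p * T = p ^ Suc k\<close>, the modes pair up so that \<open>D\<close>
    is symmetric under \<open>i \<mapsto> k + 1 - i\<close> and \<open>E\<close> under
    \<open>i \<mapsto> k - i\<close>. The conditions at the upper end thus repeat those at
    0.\<close>
  define D where "D i = d + (A * p ^ i + (A * (p * T) * (1 / p) ^ i
      + (B * q ^ i + B * (q * U) * (1 / q) ^ i)))" for i
  define E where "E i = h + (A * (g1 * p ^ i) + (A * (p * T) * (g1 / p * (1 / p) ^ i)
      + (B * (g2 * q ^ i) + B * (q * U) * (g2 / q * (1 / q) ^ i))))" for i
  have nz: "p \<noteq> 0" "q \<noteq> 0" "T \<noteq> 0" "U \<noteq> 0" "p \<noteq> 1" "q \<noteq> 1" "den (p ^ k) (q ^ k) \<noteq> 0"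
    using p_gt_1 q_gt_1 den_pos[of "p ^ k" "q ^ k"] by (auto simp: T_def U_def)
  have A: "A * den (p ^ k) (q ^ k) = 2 * p * q * (h * (1 + q * U) - d * g2 * (1 + U))"
    and B: "B * den (p ^ k) (q ^ k) = - 2 * p * q * (h * (1 + p * T) - d * g1 * (1 + T))"
    using nz by (simp_all add: A_def B_def)
  have den: "den (p ^ k) (q ^ k) = 2 * p * q * (g2 * (1 + U) * (1 + p * T) - g1 * (1 + T) * (1 + q * U))"
    by (simp add: den_eq T_def U_def)
  have "(d + A * (1 + p * T) + B * (1 + q * U)) * den (p ^ k) (q ^ k) = 0"
    "(h + A * g1 * (1 + T) + B * g2 * (1 + U)) * den (p ^ k) (q ^ k) = 0"
    using A B den by algebra+
  then have bd: "d + A * (1 + p * T) + B * (1 + q * U) = 0" "h + A * g1 * (1 + T) + B * g2 * (1 + U) = 0"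
    using nz by simp_all
  have rec: "column_rec x 1 D E"
  proof -
    have "column_rec x (1 + (A * 0 + (A * (p * T) * 0 + (B * 0 + B * (q * U) * 0)))) D E"
      unfolding D_def E_def d_def h_def
      by (intro column_rec_add column_rec_scale column_rec_const column_rec_modes disc_ne)
    then show ?thesis by simp
  qed
  have D0: "D 0 = 0" and E0: "E 0 = 0"
    using bd nz by (simp_all add: D_def E_def algebra_simps)
  have Dk: "D (Suc k) = 0" and Ek: "E k = 0"
    using bd nz by (simp_all add: D_def E_def T_def U_def power_divide algebra_simps)
  \<comment> \<open>\<open>P\<close> and \<open>Q\<close> are the geometric sums with
    \<open>k\<close> terms starting at 1. Multiplying by \<open>T\<close> or \<open>U\<close> turns
    the sums of inverse powers into the same quantities.\<close>
  define P Q where "P = (T - 1) / (p - 1)" and "Q = (U - 1) / (q - 1)"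
  have P: "P * (p - 1) = T - 1" and Q: "Q * (q - 1) = U - 1"
    using nz by (simp_all add: P_def Q_def)
  have geo: "(\<Sum>i=1..k. p ^ i) = p * P" "(\<Sum>i=1..k. q ^ i) = q * Q"
    "T * (\<Sum>i=1..k. (1 / p) ^ i) = P" "U * (\<Sum>i=1..k. (1 / q) ^ i) = Q"
    unfolding sum_geometric_Suc[OF nz(5)] sum_geometric_Suc[OF nz(6)]
      sum_geometric_inverse[OF nz(5,1)] sum_geometric_inverse[OF nz(6,2)]
      P_def Q_def T_def[symmetric] U_def[symmetric]
    using nz by (simp_all add: field_simps)
  have "(\<Sum>i=1..k. D i) = real k * d + (A * (\<Sum>i=1..k. p ^ i) + (A * (p * T) * (\<Sum>i=1..k. (1 / p) ^ i)
      + (B * (\<Sum>i=1..k. q ^ i) + B * (q * U) * (\<Sum>i=1..k. (1 / q) ^ i))))"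
    unfolding D_def sum.distrib sum_distrib_left by simp
  also have "\<dots> = real k * d + 2 * A * p * P + 2 * B * q * Q"
    using geo by algebra
  finally have sD: "(\<Sum>i=1..k. D i) = real k * d + 2 * A * p * P + 2 * B * q * Q" .
  have "(\<Sum>i=1..k. E i) = real k * h + (A * (g1 * (\<Sum>i=1..k. p ^ i))
      + (A * (p * T) * (g1 / p * (\<Sum>i=1..k. (1 / p) ^ i))
      + (B * (g2 * (\<Sum>i=1..k. q ^ i)) + B * (q * U) * (g2 / q * (\<Sum>i=1..k. (1 / q) ^ i)))))"
    unfolding E_def sum.distrib sum_distrib_left by simp
  also have "A * (p * T) * (g1 / p * (\<Sum>i=1..k. (1 / p) ^ i)) = A * g1 * (T * (\<Sum>i=1..k. (1 / p) ^ i))"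
    using nz by simp
  also have "B * (q * U) * (g2 / q * (\<Sum>i=1..k. (1 / q) ^ i)) = B * g2 * (U * (\<Sum>i=1..k. (1 / q) ^ i))"
    using nz by simp
  finally have sE: "(\<Sum>i=1..k. E i) = real k * h + A * (g1 * (1 + p)) * P + B * (g2 * (1 + q)) * Q"
    unfolding geo by (simp add: algebra_simps)
  define S where "S = (\<Sum>i=1..k. D i) + 2 * (\<Sum>i=1..k. E i)"
  have S: "S = real k * (d + 2 * h) + A * (1 - e) * p * P + B * (2 + e) * q * Q"
    unfolding S_def sD sE using g_square by algebra
  have dh: "d * (4 * x^2 - 7 * x + 1) = x" "h * (4 * x^2 - 7 * x + 1) = x * (1 - x)"
    using disc_ne by (simp_all add: d_def h_def)
  define V where "V = 4 * x^2 - 7 * x + 1"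
  \<comment> \<open>Clearing all denominators first, those of \<open>P\<close>, \<open>Q\<close>,
    \<open>A\<close>, \<open>B\<close> here and those of \<open>d\<close>, \<open>h\<close> through
    \<open>V\<close> next, leaves polynomial identities only.\<close>
  have "S * (p - 1) * (q - 1) * den (p ^ k) (q ^ k)
    = real k * (d + 2 * h) * (p - 1) * (q - 1) * den (p ^ k) (q ^ k)
      + (A * den (p ^ k) (q ^ k)) * (1 - e) * p * (P * (p - 1)) * (q - 1)
      + (B * den (p ^ k) (q ^ k)) * (2 + e) * q * (Q * (q - 1)) * (p - 1)"
    unfolding S by algebra
  also have "\<dots> * V = real k * (d * V + 2 * (h * V)) * (p - 1) * (q - 1) * den (p ^ k) (q ^ k)
      + 2 * p * q * ((h * V * (1 + q * U) - d * V * g2 * (1 + U)) * (1 - e) * p * (T - 1) * (q - 1)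
        - (h * V * (1 + p * T) - d * V * g1 * (1 + T)) * (2 + e) * q * (U - 1) * (p - 1))"
    unfolding A B P Q by algebra
  also have "\<dots> = num (real k) (p ^ k) (q ^ k)"
    unfolding num_eq dh[folded V_def] T_def[symmetric] U_def[symmetric] by algebra
  finally have "S * ((p - 1) * (q - 1) * V * den (p ^ k) (q ^ k)) = num (real k) (p ^ k) (q ^ k)"
    by (simp add: mult_ac)
  moreover have "(p - 1) * (q - 1) * V * den (p ^ k) (q ^ k) \<noteq> 0"
    using nz disc_ne by (simp add: V_def)
  ultimately have "S = num (real k) (p ^ k) (q ^ k) / ((p - 1) * (q - 1) * V * den (p ^ k) (q ^ k))"
    by (simp add: nonzero_eq_divide_eq)
  with rec D0 E0 Dk Ek show ?thesis
    using that unfolding S_def V_def by blast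
qed

end

section \<open>The roots in radicals and the closed form for small \<open>x\<close>\<close>

text \<open>This is the quadratic formula for \<open>t * t - s * t + 1\<close> with numerator and
  denominator scaled by \<open>2 * x\<close>, the shape in which \<open>t1\<close> and
  \<open>t2\<close> are given. The condition \<open>s > 2\<close> makes the roots real and
  distinct.\<close>

lemma larger_root:
  fixes x s u :: real
  assumes "x > 0" "s > 2" "u = 2 * x * s"
  defines "t \<equiv> (u + sqrt (u^2 - 16 * x^2)) / (4 * x)"
  shows "t * t = s * t - 1" "t > 1"
proof -
  have "u^2 - 16 * x^2 = (2 * x)^2 * (s * s - 2 * 2)"
    unfolding assms(3) by algebra
  moreover have "s * s - 2 * 2 \<ge> 0"
    using mult_mono[of 2 s 2 s] assms(2) by simp
  ultimately have nonneg: "u^2 - 16 * x^2 \<ge> 0"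
    by simp
  define r where "r = sqrt (u^2 - 16 * x^2)"
  have r: "r \<ge> 0" "r * r = u^2 - 16 * x^2"
    using nonneg by (simp_all add: r_def)
  have t: "4 * x * t = u + r"
    using assms(1) by (simp add: t_def r_def)
  have "(16 * x * x) * (t * t - (s * t - 1)) = 0"
    using r(2) t assms(3) by algebra
  then show "t * t = s * t - 1"
    using assms(1) by simp
  have "4 * x * 1 < u"
    unfolding assms(3) using mult_strict_left_mono[of 2 s "2 * x"] assms(1,2) by simp
  then have "4 * x * 1 < 4 * x * t"
    unfolding t using r(1) by simp
  then show "t > 1"
    using assms(1) by simp
qed

lemma kernel_roots_t1_t2:
  fixes x :: real
  assumes "0 < x" "x < 1 / 9"
  shows "kernel_roots x (1 / x) ((sqrt (x * (9 * x + 8)) / x - 1) / 2) (t1 x) (t2 x)"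
proof -
  define r where "r = sqrt (x * (9 * x + 8))"
  have rr: "r * r = x * (9 * x + 8)"
    using assms by (simp add: r_def)
  have disc: "4 * x^2 - 7 * x + 1 > 0"
    using assms zero_le_power2[of x] by linarith
  \<comment> \<open>This is \<open>e > 1\<close> in terms of \<open>r\<close>.\<close>
  have r_lower: "r > 3 * x"
    unfolding r_def using assms by (intro real_less_rsqrt) (simp add: power2_eq_square algebra_simps)
  \<comment> \<open>The difference of the two sides is \<open>4 * (4 * x^2 - 7 * x + 1)\<close>. The
    resulting bound on \<open>r\<close> says that the smaller kernel value exceeds 2.\<close>
  have "x * (9 * x + 8) < (2 - 5 * x)^2"
    using disc by (simp add: power2_eq_square algebra_simps)
  then have r_upper: "r < 2 - 5 * x"
    unfolding r_def using assms by (intro real_less_lsqrt) auto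
  have u: "2 - x + r = 2 * x * (1 / x + (r / x - 1) / 2)"
    "2 - x - r = 2 * x * (1 / x - 1 - (r / x - 1) / 2)"
    using assms by (simp_all add: field_simps)
  have "2 * x * 2 < 2 * x * (1 / x + (r / x - 1) / 2)" "2 * x * 2 < 2 * x * (1 / x - 1 - (r / x - 1) / 2)"
    unfolding u[symmetric] using r_lower r_upper assms by simp_all
  then have s: "1 / x + (r / x - 1) / 2 > 2" "1 / x - 1 - (r / x - 1) / 2 > 2"
    using assms(1) by (simp_all only: mult_less_cancel_left_pos zero_less_numeral mult_pos_pos)
  note root1 = larger_root[OF assms(1) s(1) u(1), folded t1_def[of x, folded r_def]]
  note root2 = larger_root[OF assms(1) s(2) u(2), folded t2_def[of x, folded r_def]]
  show ?thesis
    unfolding r_def[symmetric]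
  proof
    show "(r / x - 1) / 2 * ((r / x - 1) / 2) = 2 * (1 / x) + 2 - (r / x - 1) / 2"
      using assms rr by (simp add: field_simps)
    show "(r / x - 1) / 2 > 1"
      using assms r_lower by (simp add: field_simps)
  qed (use assms disc root1 root2 in auto)
qed

lemma staircase_gf_sums_closed_form:
  fixes k :: nat
  assumes "0 < x" "x < 1 / 9"
  shows "(\<lambda>n. fps_nth (staircase_gf k) n * x ^ n) sums
         ((a1 (real k) x (t1 x) (t2 x) * t1 x ^ k * t2 x ^ k
            + a2 (real k) x (t1 x) (t2 x) * t1 x ^ k
            - a2 (real k) x (t2 x) (t1 x) * t2 x ^ k
            + a3 (real k) x (t1 x) (t2 x))
         / ((t1 x - 1) * (t2 x - 1) * (4 * x^2 - 7 * x + 1)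
            * (b1 x (t1 x) (t2 x) * t1 x ^ k * t2 x ^ k
               + b2 x (t1 x) (t2 x) * t1 x ^ k
               - b2 x (t2 x) (t1 x) * t2 x ^ k
               + b3 x (t1 x) (t2 x))))"
proof -
  interpret kernel_roots x "1 / x" "(sqrt (x * (9 * x + 8)) / x - 1) / 2" "t1 x" "t2 x"
    by (rule kernel_roots_t1_t2[OF assms])
  obtain D E where sol: "column_rec x 1 D E" "D 0 = 0" "E 0 = 0" "D (Suc k) = 0" "E k = 0"
    and total: "(\<Sum>i=1..k. D i) + 2 * (\<Sum>i=1..k. E i)
      = num (real k) (t1 x ^ k) (t2 x ^ k)
        / ((t1 x - 1) * (t2 x - 1) * (4 * x^2 - 7 * x + 1) * den (t1 x ^ k) (t2 x ^ k))"
    by (rule explicit_solution)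
  have "(\<lambda>n. fps_nth (staircase_gf k) n * x ^ n) sums ((\<Sum>i=1..k. D i) + 2 * (\<Sum>i=1..k. E i))"
    using assms by (intro staircase_gf_sums_from_recurrence[OF sol]) auto
  then show ?thesis
    unfolding total num_def den_def .
qed

theorem theorem12:
  fixes k :: nat
  assumes "k \<ge> 1"
  shows "fps_conv_radius (staircase_gf k) > 0 \<and>
    (\<forall>\<^sub>F x in at_right (0::real).
       eval_fps (staircase_gf k) x =
         (a1 (real k) x (t1 x) (t2 x) * t1 x ^ k * t2 x ^ k
            + a2 (real k) x (t1 x) (t2 x) * t1 x ^ k
            - a2 (real k) x (t2 x) (t1 x) * t2 x ^ k
            + a3 (real k) x (t1 x) (t2 x))
         / ((t1 x - 1) * (t2 x - 1) * (4 * x^2 - 7 * x + 1)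
            * (b1 x (t1 x) (t2 x) * t1 x ^ k * t2 x ^ k
               + b2 x (t1 x) (t2 x) * t1 x ^ k
               - b2 x (t2 x) (t1 x) * t2 x ^ k
               + b3 x (t1 x) (t2 x))))"
proof
  \<comment> \<open>The point \<open>1 / 10\<close> is a sample from the interval below
    \<open>1 / 9\<close>; convergence there bounds the radius from below.\<close>
  have "summable (\<lambda>n. fps_nth (staircase_gf k) n * (1 / 10) ^ n)"
    using staircase_gf_sums_closed_form[of "1 / 10" k] by (simp add: sums_iff)
  then have "fps_conv_radius (staircase_gf k) \<ge> norm (1 / 10 :: real)"
    unfolding fps_conv_radius_def by (rule conv_radius_geI)
  then show "fps_conv_radius (staircase_gf k) > 0"
    by (rule less_le_trans[rotated]) simp
next
  have "\<forall>\<^sub>F x in at_right (0::real). x \<in> {0<..<1 / 9}"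
    by (rule eventually_at_right_real) simp
  then show "\<forall>\<^sub>F x in at_right (0::real).
       eval_fps (staircase_gf k) x =
         (a1 (real k) x (t1 x) (t2 x) * t1 x ^ k * t2 x ^ k
            + a2 (real k) x (t1 x) (t2 x) * t1 x ^ k
            - a2 (real k) x (t2 x) (t1 x) * t2 x ^ k
            + a3 (real k) x (t1 x) (t2 x))
         / ((t1 x - 1) * (t2 x - 1) * (4 * x^2 - 7 * x + 1)
            * (b1 x (t1 x) (t2 x) * t1 x ^ k * t2 x ^ k
               + b2 x (t1 x) (t2 x) * t1 x ^ k
               - b2 x (t2 x) (t1 x) * t2 x ^ k
               + b3 x (t1 x) (t2 x)))"
    unfolding eval_fps_def
    by (rule eventually_mono) (use sums_unique[OF staircase_gf_sums_closed_form] in auto)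
qed

end
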